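(* Let $1\le \ell\le d$ be integers and let $(\mathbf{P}_k)_{k\ge 0}$ be i.i.d. random matrices in $\mathbb{R}^{d\times \ell}$ such that $\mathbb{E}\,\mathbf{P}_k\mathbf{P}_k^\top=\mathbf{I}_d$ and $\mathbf{P}_k^\top\mathbf{P}_k=(d/\ell)\,\mathbf{I}_\ell$. Let $f:\mathbb{R}^d\to\mathbb{R}$ be continuously differentiable with $\lambda$-Lipschitz first derivative and suppose $f$ attains its minimum $f_*$. Let $\mathbf{x}_0\in\mathbb{R}^d$ be an arbitrary initialization and, with $\alpha=\ell/(d\lambda)$, define $$\mathbf{x}_{k+1}=\mathbf{x}_k-\alpha\,\mathbf{P}_k\mathbf{P}_k^\top\nabla f(\mathbf{x}_k),\qquad k\ge 0.$$ Then $$\min_{i\in\{0,\ldots,k\}}\mathbb{E}\|\nabla f(\mathbf{x}_i)\|^2\le\frac{2d\lambda\,(f(\mathbf{x}_0)-f_* )}{(k+1)\ell}.$$ That is, $k=\mathcal{O}(d/(\ell\epsilon))$ iterations are required to achieve $\mathbb{E}\|\nabla f(\mathbf{x}_k)\|^2<\epsilon$.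
   Context: $\|\cdot\|$ is the Euclidean norm on $\mathbb{R}^d$, and $\mathbf{I}_n$ is the $n\times n$ identity matrix. $f$ is not assumed convex. *)

theory Defs
  imports "HOL-Probability.Probability"
begin

text \<open>Randomness enters through the matrices only, so for a sequence of random matrices
  \<open>P :: nat \<Rightarrow> 's \<Rightarrow> real ^ 'l ^ 'd\<close> on a sample space \<open>'s\<close>, the iterates are defined
  pathwise in the outcome \<open>\<omega>\<close>. The argument \<open>g\<close> is the gradient field of the objective.\<close>

primrec subspace_descent ::
  "real \<Rightarrow> (nat \<Rightarrow> 's \<Rightarrow> real ^ 'l ^ 'd) \<Rightarrow> (real ^ 'd \<Rightarrow> real ^ 'd)
     \<Rightarrow> real ^ 'd \<Rightarrow> nat \<Rightarrow> 's \<Rightarrow> real ^ 'd" where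
  "subspace_descent \<alpha> P g x0 0 \<omega> = x0"
| "subspace_descent \<alpha> P g x0 (Suc k) \<omega> =
     subspace_descent \<alpha> P g x0 k \<omega>
       - \<alpha> *\<^sub>R ((P k \<omega> ** transpose (P k \<omega>)) *v g (subspace_descent \<alpha> P g x0 k \<omega>))"

end

theory Submission
  imports Defs
begin

text \<open>Along a direction in the range of \<open>P P\<^sup>T\<close> the quadratic upper bound for \<open>f\<close> and
  \<open>P\<^sup>T P = (d/\<ell>) I\<close> combine, for this step size, to the pathwise decrease
  \<open>f x\<^sub>k\<^sub>+\<^sub>1 \<le> f x\<^sub>k - (\<alpha>/2) \<parallel>P\<^sub>k\<^sup>T \<nabla>f x\<^sub>k\<parallel>\<^sup>2\<close>. Since \<open>x\<^sub>k\<close> depends on \<open>P\<^sub>0, \<dots>, P\<^sub>k\<^sub>-\<^sub>1\<close> only, it is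
  independent of \<open>P\<^sub>k\<close>, and \<open>E P\<^sub>k P\<^sub>k\<^sup>T = I\<close> turns the expected decrease into
  \<open>(\<alpha>/2) E \<parallel>\<nabla>f x\<^sub>k\<parallel>\<^sup>2\<close>; telescoping finishes the argument. All integrability questions are trivial
  because the orthogonality relation makes every iterate essentially bounded.\<close>

section \<open>Smoothness inequality and Gram matrix algebra\<close>

text \<open>Monotonicity in one variable replaces integration along the segment: Cauchy-Schwarz and
  the Lipschitz bound make the derivative of the gap \<open>\<phi>\<close> nonpositive for
  \<open>0 \<le> t\<close>.\<close>

lemma lipschitz_gradient_quadratic_upper_bound:
  fixes f :: "'a::real_inner \<Rightarrow> real"
  assumes grad: "\<And>y. GDERIV f y :> g y" and Lip: "L-lipschitz_on UNIV g"
  shows "f (x + h) \<le> f x + g x \<bullet> h + L / 2 * (norm h)\<^sup>2"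
proof -
  define \<phi> where "\<phi> t = f (x + t *\<^sub>R h) - t * (g x \<bullet> h) - L / 2 * t\<^sup>2 * (norm h)\<^sup>2" for t
  define \<phi>' where "\<phi>' t = g (x + t *\<^sub>R h) \<bullet> h - g x \<bullet> h - L * t * (norm h)\<^sup>2" for t
  have "(\<phi> has_real_derivative \<phi>' t) (at t)" for t
  proof -
    have "((\<lambda>t. f (x + t *\<^sub>R h)) has_derivative (\<lambda>s. (s *\<^sub>R h) \<bullet> g (x + t *\<^sub>R h))) (at t)"
      by (rule has_derivative_compose[where g = f, of "\<lambda>t. x + t *\<^sub>R h"])
        (use grad[of "x + t *\<^sub>R h"] in \<open>auto simp: gderiv_def intro!: derivative_eq_intros\<close>)
    then have "((\<lambda>t. f (x + t *\<^sub>R h)) has_real_derivative g (x + t *\<^sub>R h) \<bullet> h) (at t)"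
      unfolding has_field_derivative_def
      by (rule has_derivative_eq_rhs) (simp add: fun_eq_iff inner_commute)
    then show ?thesis
      unfolding \<phi>_def[abs_def] \<phi>'_def by (auto intro!: derivative_eq_intros)
  qed
  moreover have "\<phi>' t \<le> 0" if "0 \<le> t" for t
  proof -
    have "g (x + t *\<^sub>R h) \<bullet> h - g x \<bullet> h \<le> norm (g (x + t *\<^sub>R h) - g x) * norm h"
      by (metis inner_diff_left norm_cauchy_schwarz)
    also have "\<dots> \<le> (L * norm (t *\<^sub>R h)) * norm h"
      using lipschitz_onD[OF Lip, of "x + t *\<^sub>R h" x]
      by (intro mult_right_mono) (auto simp: dist_norm)
    finally show ?thesis
      using that by (simp add: \<phi>'_def power2_eq_square)
  qed
  ultimately have "\<phi> 1 \<le> \<phi> 0"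
    by (intro DERIV_nonpos_imp_nonincreasing[of 0 1]) auto
  then show ?thesis by (simp add: \<phi>_def)
qed

lemma inner_gram_matrix_vector:
  fixes A :: "real ^ 'l ^ 'd"
  shows "v \<bullet> ((A ** transpose A) *v v) = (norm (transpose A *v v))\<^sup>2"
  by (metis dot_lmul_matrix matrix_vector_mul_assoc power2_norm_eq_inner transpose_matrix_vector)

text \<open>The hypothesis says that \<open>A\<close> scales squared norms by \<open>c\<close>. This
  makes the second-order term of the descent estimate a multiple of the first-order one.\<close>

lemma norm_gram_matrix_vector_sq:
  fixes A :: "real ^ 'l ^ 'd"
  assumes "transpose A ** A = c *\<^sub>R mat 1"
  shows "(norm ((A ** transpose A) *v v))\<^sup>2 = c * (v \<bullet> ((A ** transpose A) *v v))"
proof -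
  define u where "u = transpose A *v v"
  \<comment> \<open>Taking the transpose for \<open>A\<close> in the quadratic form identity swaps
    the two Gram matrices.\<close>
  have "(norm (A *v u))\<^sup>2 = u \<bullet> ((transpose A ** A) *v u)"
    using inner_gram_matrix_vector[of u "transpose A"] by simp
  also have "\<dots> = c * (norm u)\<^sup>2"
    by (simp add: assms power2_norm_eq_inner flip: scaleR_matrix_vector_assoc)
  finally show ?thesis
    by (simp only: inner_gram_matrix_vector u_def matrix_vector_mul_assoc)
qed

text \<open>Cauchy-Schwarz applied to the preceding identity, with one factor \<open>norm w\<close>
  cancelled. The bound depends on \<open>A\<close> only through \<open>c\<close>, so it controls
  random steps deterministically.\<close>

lemma norm_gram_matrix_vector_le:
  fixes A :: "real ^ 'l ^ 'd"
  assumes "transpose A ** A = c *\<^sub>R mat 1" "c \<ge> 0"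
  shows "norm ((A ** transpose A) *v v) \<le> c * norm v"
proof -
  define w where "w = (A ** transpose A) *v v"
  have "norm w * norm w \<le> (c * norm v) * norm w"
    using norm_gram_matrix_vector_sq[OF assms(1), of v] norm_cauchy_schwarz[of v w] \<open>c \<ge> 0\<close>
    by (simp add: w_def power2_eq_square mult.assoc mult_left_mono)
  then show ?thesis
    using \<open>c \<ge> 0\<close> by (cases "w = 0") (auto simp flip: w_def)
qed

section \<open>Measurability of the iterates and independence from the next matrix\<close>

lemma continuous_on_gram_matrix_vector:
  "continuous_on UNIV (\<lambda>z :: (real ^ 'l ^ 'd) \<times> (real ^ 'd). (fst z ** transpose (fst z)) *v snd z)"
  unfolding matrix_vector_mult_def matrix_matrix_mult_def transpose_def
  by (intro continuous_on_vec_lambda) (simp, intro continuous_intros)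

lemma borel_measurable_gram_matrix_entry:
  "(\<lambda>A :: real ^ 'l ^ 'd. (A ** transpose A) $ i $ j) \<in> borel_measurable borel"
  unfolding matrix_matrix_mult_def transpose_def
  by (intro borel_measurable_continuous_onI) (simp, intro continuous_intros)

text \<open>Asking only for indices below \<open>k\<close>, over an arbitrary \<open>N\<close>,
  makes this applicable on the finite product space over \<open>{..<k}\<close> as well.\<close>

lemma borel_measurable_subspace_descent:
  fixes P :: "nat \<Rightarrow> 's \<Rightarrow> real ^ 'l ^ 'd"
  assumes P: "\<And>i. i < k \<Longrightarrow> P i \<in> borel_measurable N" and g: "g \<in> borel_measurable borel"
  shows "subspace_descent \<alpha> P g x0 k \<in> borel_measurable N"
  using P
proof (induction k)
  case 0
  then show ?case by (simp add: measurable_cong[of N "subspace_descent \<alpha> P g x0 0" "\<lambda>_. x0"])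
next
  case (Suc k)
  let ?x = "subspace_descent \<alpha> P g x0 k"
  have [measurable]: "?x \<in> borel_measurable N" "P k \<in> borel_measurable N"
    using Suc by auto
  have "(\<lambda>\<omega>. g (?x \<omega>)) \<in> borel_measurable N"
    using g by measurable
  then have [measurable]: "(\<lambda>\<omega>. (P k \<omega> ** transpose (P k \<omega>)) *v g (?x \<omega>)) \<in> borel_measurable N"
    by (rule borel_measurable_continuous_Pair[of "P k", OF _ _ continuous_on_gram_matrix_vector, rotated]) simp
  show ?case
    by (subst measurable_cong[OF subspace_descent.simps(2)]) measurable
qed

text \<open>The two outcomes may live in different sample spaces, which allows an iterate to be
  transported to the space of matrix sequences.\<close>

lemma subspace_descent_cong:
  assumes "\<And>i. i < k \<Longrightarrow> P i \<omega> = Q i \<omega>'"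
  shows "subspace_descent \<alpha> P g x0 k \<omega> = subspace_descent \<alpha> Q g x0 k \<omega>'"
  using assms by (induction k) auto

text \<open>\<^const>\<open>prob_space.indep_var\<close> only relates random variables of one type, so independence of
  \<open>x\<^sub>k\<close> and \<open>P\<^sub>k\<close> is expressed through their real-valued functions.\<close>

lemma (in prob_space) indep_var_subspace_descent:
  fixes P :: "nat \<Rightarrow> 'a \<Rightarrow> real ^ 'l ^ 'd" and \<phi> \<psi> :: "_ \<Rightarrow> real"
  assumes ind: "indep_vars (\<lambda>_. borel) P UNIV" and g: "g \<in> borel_measurable borel"
    and \<phi>: "\<phi> \<in> borel_measurable borel" and \<psi>: "\<psi> \<in> borel_measurable borel"
  shows "indep_var borel (\<lambda>\<omega>. \<phi> (subspace_descent \<alpha> P g x0 k \<omega>)) borel (\<lambda>\<omega>. \<psi> (P k \<omega>))"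
proof -
  \<comment> \<open>Matrix sequences serve as outcomes and coordinates as random matrices, so
    \<open>X\<close> is the iterate as an explicit function of the matrices.\<close>
  define X where "X = subspace_descent \<alpha> (\<lambda>i p :: nat \<Rightarrow> real ^ 'l ^ 'd. p i) g x0 k"
  \<comment> \<open>Disjoint index blocks of an independent family are independent: here the past
    and the current step.\<close>
  have "indep_var (PiM {..<k} (\<lambda>_. borel)) (\<lambda>\<omega>. restrict (\<lambda>i. P i \<omega>) {..<k})
                  (PiM {k} (\<lambda>_. borel)) (\<lambda>\<omega>. restrict (\<lambda>i. P i \<omega>) {k})"
    by (rule indep_var_restrict[OF ind]) auto
  moreover have "X \<in> borel_measurable (PiM {..<k} (\<lambda>_. borel))"
    unfolding X_def by (rule borel_measurable_subspace_descent[OF _ g]) auto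
  then have "(\<lambda>p. \<phi> (X p)) \<in> borel_measurable (PiM {..<k} (\<lambda>_. borel))"
    using \<phi> by (rule measurable_compose)
  moreover have "(\<lambda>p. \<psi> (p k)) \<in> borel_measurable (PiM {k} (\<lambda>_. borel))"
    by (rule measurable_compose[OF _ \<psi>]) simp
  ultimately have "indep_var borel ((\<lambda>p. \<phi> (X p)) \<circ> (\<lambda>\<omega>. restrict (\<lambda>i. P i \<omega>) {..<k}))
                             borel ((\<lambda>p. \<psi> (p k)) \<circ> (\<lambda>\<omega>. restrict (\<lambda>i. P i \<omega>) {k}))"
    by (rule indep_var_compose)
  moreover have "X (restrict (\<lambda>i. P i \<omega>) {..<k}) = subspace_descent \<alpha> P g x0 k \<omega>" for \<omega>
    unfolding X_def by (rule subspace_descent_cong) simp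
  ultimately show ?thesis by (simp add: comp_def)
qed

section \<open>Essential boundedness and integrability\<close>

lemma AE_bounded_continuous_image:
  fixes X :: "'s \<Rightarrow> 'a::heine_borel" and h :: "'a \<Rightarrow> 'b::real_normed_vector"
  assumes "AE \<omega> in M. X \<omega> \<in> cball c B" "continuous_on UNIV h"
  obtains C where "AE \<omega> in M. norm (h (X \<omega>)) \<le> C"
proof -
  have "bounded (h ` cball c B)"
    using assms(2) by (intro compact_imp_bounded compact_continuous_image)
      (auto intro: continuous_on_subset)
  then obtain C where "\<And>y. y \<in> cball c B \<Longrightarrow> norm (h y) \<le> C"
    unfolding bounded_iff by blast
  with assms(1) have "AE \<omega> in M. norm (h (X \<omega>)) \<le> C"
    by (auto elim: eventually_mono)
  then show thesis by (rule that)
qed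

text \<open>The bound is deterministic but may grow with \<open>k\<close>: compactness of the
  previous ball bounds \<open>g\<close> there by \<open>G\<close>, and one step then adds at most
  \<open>\<bar>\<alpha>\<bar> * (c * G)\<close>.\<close>

lemma AE_bounded_subspace_descent:
  fixes P :: "nat \<Rightarrow> 's \<Rightarrow> real ^ 'l ^ 'd"
  assumes orth: "\<And>i. AE \<omega> in M. transpose (P i \<omega>) ** P i \<omega> = c *\<^sub>R mat 1" and "c \<ge> 0"
    and g: "continuous_on UNIV g"
  shows "\<exists>B. AE \<omega> in M. subspace_descent \<alpha> P g x0 k \<omega> \<in> cball 0 B"
proof (induction k)
  case 0
  show ?case by (auto intro!: exI[of _ "norm x0"])
next
  case (Suc k)
  let ?x = "subspace_descent \<alpha> P g x0 k"
  from Suc obtain B where B: "AE \<omega> in M. ?x \<omega> \<in> cball 0 B" by blast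
  then obtain G where G: "AE \<omega> in M. norm (g (?x \<omega>)) \<le> G"
    by (rule AE_bounded_continuous_image[OF _ g])
  have "AE \<omega> in M. subspace_descent \<alpha> P g x0 (Suc k) \<omega> \<in> cball 0 (B + \<bar>\<alpha>\<bar> * (c * G))"
    using B G orth[of k]
  proof eventually_elim
    case (elim \<omega>)
    let ?w = "(P k \<omega> ** transpose (P k \<omega>)) *v g (?x \<omega>)"
    have "norm ?w \<le> c * norm (g (?x \<omega>))"
      using elim(3) \<open>c \<ge> 0\<close> by (rule norm_gram_matrix_vector_le)
    also have "\<dots> \<le> c * G"
      using elim(2) \<open>c \<ge> 0\<close> by (rule mult_left_mono)
    finally have "norm (\<alpha> *\<^sub>R ?w) \<le> \<bar>\<alpha>\<bar> * (c * G)"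
      by (simp add: mult_left_mono)
    then show ?case
      using elim(1) norm_triangle_ineq4[of "?x \<omega>" "\<alpha> *\<^sub>R ?w"] by simp
  qed
  then show ?case by blast
qed

lemma (in finite_measure) integrable_continuous_AE_bounded:
  fixes X :: "'a \<Rightarrow> 'b::euclidean_space" and h :: "'b \<Rightarrow> real"
  assumes "AE \<omega> in M. X \<omega> \<in> cball c B" "X \<in> borel_measurable M" "continuous_on UNIV h"
  shows "integrable M (\<lambda>\<omega>. h (X \<omega>))"
proof -
  obtain C where "AE \<omega> in M. norm (h (X \<omega>)) \<le> C"
    using AE_bounded_continuous_image[OF assms(1,3)] by blast
  moreover have "(\<lambda>\<omega>. h (X \<omega>)) \<in> borel_measurable M"
    by (rule borel_measurable_continuous_on[OF assms(3,2)])
  ultimately show ?thesis by (rule integrable_const_bound)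
qed

section \<open>Expected quadratic form and convergence rate\<close>

text \<open>Expanded in coordinates, each summand is a product of
  \<open>V \<omega> $ i * V \<omega> $ j\<close> with an independent matrix entry. Its expectation
  factors, and the identity mean leaves only the diagonal.\<close>

lemma (in prob_space) expectation_gram_matrix_quadratic_form:
  fixes V :: "'a \<Rightarrow> real ^ 'd" and P :: "'a \<Rightarrow> real ^ 'l ^ 'd"
  assumes ind: "\<And>\<phi> \<psi> :: _ \<Rightarrow> real. \<phi> \<in> borel_measurable borel \<Longrightarrow> \<psi> \<in> borel_measurable borel \<Longrightarrow>
        indep_var borel (\<lambda>\<omega>. \<phi> (V \<omega>)) borel (\<lambda>\<omega>. \<psi> (P \<omega>))"
    and V_meas: "V \<in> borel_measurable M" and bdd: "AE \<omega> in M. norm (V \<omega>) \<le> B"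
    and mean: "expectation (\<lambda>\<omega>. P \<omega> ** transpose (P \<omega>)) = mat 1"
  shows "integrable M (\<lambda>\<omega>. V \<omega> \<bullet> ((P \<omega> ** transpose (P \<omega>)) *v V \<omega>))"
    and "expectation (\<lambda>\<omega>. V \<omega> \<bullet> ((P \<omega> ** transpose (P \<omega>)) *v V \<omega>)) = expectation (\<lambda>\<omega>. (norm (V \<omega>))\<^sup>2)"
proof -
  let ?A = "\<lambda>\<omega>. P \<omega> ** transpose (P \<omega>)"
  \<comment> \<open>The integral of a non-integrable function is \<open>0\<close>.\<close>
  have A: "integrable M ?A"
  proof (rule ccontr)
    assume "\<not> integrable M ?A"
    then have "(mat 1 :: real ^ 'd ^ 'd) = 0"
      using mean by (simp add: not_integrable_integral_eq)
    then have "(mat 1 :: real ^ 'd ^ 'd) $ i $ i = 0" for i by simp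
    then show False by (simp add: mat_def)
  qed
  have entry: "bounded_linear (\<lambda>A :: real ^ 'd ^ 'd. A $ i $ j)" for i j
    by (intro bounded_linear_compose[OF bounded_linear_vec_nth] bounded_linear_vec_nth)
  have A_int: "integrable M (\<lambda>\<omega>. ?A \<omega> $ i $ j)" for i j
    using entry A by (rule integrable_bounded_linear)
  have A_exp: "expectation (\<lambda>\<omega>. ?A \<omega> $ i $ j) = mat 1 $ i $ j" for i j
    using integral_bounded_linear[OF entry A] mean by simp
  have VV_int: "integrable M (\<lambda>\<omega>. V \<omega> $ i * V \<omega> $ j)" for i j
    using bdd V_meas integrable_continuous_AE_bounded[of V 0 B "\<lambda>v. v $ i * v $ j"]
    by (simp add: continuous_on_mult continuous_on_component)
  have ind': "indep_var borel (\<lambda>\<omega>. V \<omega> $ i * V \<omega> $ j) borel (\<lambda>\<omega>. ?A \<omega> $ i $ j)" for i j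
    by (rule ind[OF _ borel_measurable_gram_matrix_entry, of "\<lambda>v. v $ i * v $ j"])
      (intro borel_measurable_continuous_onI continuous_intros)
  have int: "integrable M (\<lambda>\<omega>. (V \<omega> $ i * V \<omega> $ j) * ?A \<omega> $ i $ j)" for i j
    by (rule indep_var_integrable[OF ind' VV_int A_int])
  have eq: "V \<omega> \<bullet> (?A \<omega> *v V \<omega>) = (\<Sum>i\<in>UNIV. \<Sum>j\<in>UNIV. (V \<omega> $ i * V \<omega> $ j) * ?A \<omega> $ i $ j)" for \<omega>
    by (simp add: inner_vec_def matrix_vector_mult_def sum_distrib_left mult_ac)
  show "integrable M (\<lambda>\<omega>. V \<omega> \<bullet> (?A \<omega> *v V \<omega>))"
    unfolding eq using int by (intro Bochner_Integration.integrable_sum)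
  have "expectation (\<lambda>\<omega>. V \<omega> \<bullet> (?A \<omega> *v V \<omega>))
      = (\<Sum>i\<in>UNIV. \<Sum>j\<in>UNIV. expectation (\<lambda>\<omega>. V \<omega> $ i * V \<omega> $ j) * mat 1 $ i $ j)"
    unfolding eq using int
    by (simp add: Bochner_Integration.integral_sum indep_var_lebesgue_integral[OF ind' VV_int A_int] A_exp)
  also have "\<dots> = (\<Sum>i\<in>UNIV. expectation (\<lambda>\<omega>. V \<omega> $ i * V \<omega> $ i))"
    by (simp add: mat_def if_distrib[of "(*) _"] cong: if_cong)
  also have "\<dots> = expectation (\<lambda>\<omega>. (norm (V \<omega>))\<^sup>2)"
    unfolding power2_norm_eq_inner inner_vec_def using VV_int
    by (simp add: Bochner_Integration.integral_sum)
  finally show "expectation (\<lambda>\<omega>. V \<omega> \<bullet> (?A \<omega> *v V \<omega>)) = expectation (\<lambda>\<omega>. (norm (V \<omega>))\<^sup>2)" .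
qed

theorem theorem3:
  fixes M :: "'s measure"
    and P :: "nat \<Rightarrow> 's \<Rightarrow> real ^ 'l ^ 'd"
    and f :: "real ^ 'd \<Rightarrow> real"
    and grad_f :: "real ^ 'd \<Rightarrow> real ^ 'd"
    and lam fstar \<alpha> :: real
    and x0 :: "real ^ 'd"
    and x :: "nat \<Rightarrow> 's \<Rightarrow> real ^ 'd"
  assumes "prob_space M"
    and "CARD('l) \<le> CARD('d)"
    and P_indep: "prob_space.indep_vars M (\<lambda>_. borel) P UNIV"
    and P_ident: "\<And>k. distr M borel (P k) = distr M borel (P 0)"
    and P_mean: "\<And>k. prob_space.expectation M (\<lambda>\<omega>. P k \<omega> ** transpose (P k \<omega>)) = mat 1"
    and P_orth: "\<And>k. AE \<omega> in M. transpose (P k \<omega>) ** P k \<omega>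
                   = (real CARD('d) / real CARD('l)) *\<^sub>R mat 1"
    and f_grad: "\<And>y. GDERIV f y :> grad_f y"
    and f_C1: "continuous_on UNIV grad_f"
    and "lam > 0"
    and f_Lip: "lam-lipschitz_on UNIV grad_f"
    and f_min: "\<exists>y. f y = fstar" "\<And>y. fstar \<le> f y"
    and \<alpha>: "\<alpha> = real CARD('l) / (real CARD('d) * lam)"
    and x: "x = subspace_descent \<alpha> P grad_f x0"
  shows "(\<forall>i. integrable M (\<lambda>\<omega>. (norm (grad_f (x i \<omega>)))\<^sup>2)) \<and>
         (\<forall>k. (MIN i\<in>{0..k}. prob_space.expectation M (\<lambda>\<omega>. (norm (grad_f (x i \<omega>)))\<^sup>2))
                \<le> 2 * real CARD('d) * lam * (f x0 - fstar) / ((real k + 1) * real CARD('l))) \<and>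
         (\<forall>\<epsilon>>0. \<exists>k. real k \<le> 2 * lam * (f x0 - fstar) * (real CARD('d) / (real CARD('l) * \<epsilon>)) \<and>
                prob_space.expectation M (\<lambda>\<omega>. (norm (grad_f (x k \<omega>)))\<^sup>2) < \<epsilon>)"
proof -
  interpret prob_space M by fact
  define c where "c = real CARD('d) / real CARD('l)"
  have "c > 0" by (simp add: c_def)
  have \<alpha>_c: "\<alpha> = 1 / (c * lam)" by (simp add: c_def \<alpha>)
  have "\<alpha> > 0" using \<open>c > 0\<close> \<open>lam > 0\<close> by (simp add: \<alpha>_c)
  note orth = P_orth[folded c_def]
  define E where "E i = expectation (\<lambda>\<omega>. (norm (grad_f (x i \<omega>)))\<^sup>2)" for i
  \<comment> \<open>This is \<open>2 / \<alpha>\<close> times the initial gap, the bound that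
    telescoping gives for every partial sum of \<open>E\<close>.\<close>
  define C where "C = 2 * real CARD('d) * lam * (f x0 - fstar) / real CARD('l)"
  have "f x0 \<ge> fstar" by (rule f_min)
  have x_Suc: "x (Suc k) \<omega> = x k \<omega> + - \<alpha> *\<^sub>R ((P k \<omega> ** transpose (P k \<omega>)) *v grad_f (x k \<omega>))" for k \<omega>
    by (simp add: x)
  have f_cont: "continuous_on UNIV f"
    using f_grad by (auto simp: gderiv_def continuous_on_eq_continuous_at dest: has_derivative_continuous)
  have g_meas [measurable]: "grad_f \<in> borel_measurable borel"
    using f_C1 by (rule borel_measurable_continuous_onI)
  have P_meas: "P k \<in> borel_measurable M" for k
    using P_indep by (auto simp: indep_vars_def)
  have x_meas [measurable]: "x k \<in> borel_measurable M" for k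
    unfolding x by (rule borel_measurable_subspace_descent[OF P_meas g_meas])
  have x_bdd: "\<exists>B. AE \<omega> in M. x k \<omega> \<in> cball 0 B" for k
    unfolding x using orth \<open>c > 0\<close> f_C1 by (intro AE_bounded_subspace_descent) auto
  have h_int: "integrable M (\<lambda>\<omega>. h (x k \<omega>))" if "continuous_on UNIV h" for h :: "real ^ 'd \<Rightarrow> real" and k
    using x_bdd[of k] integrable_continuous_AE_bounded[OF _ x_meas that] by blast
  have g_int: "integrable M (\<lambda>\<omega>. (norm (grad_f (x k \<omega>)))\<^sup>2)" for k
    by (rule h_int) (intro continuous_intros f_C1)
  note f_int = h_int[OF f_cont]

  have decrease: "expectation (\<lambda>\<omega>. f (x (Suc k) \<omega>)) \<le> expectation (\<lambda>\<omega>. f (x k \<omega>)) - \<alpha> / 2 * E k" for k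
  proof -
    define q where "q \<omega> = grad_f (x k \<omega>) \<bullet> ((P k \<omega> ** transpose (P k \<omega>)) *v grad_f (x k \<omega>))" for \<omega>
    have ind: "indep_var borel (\<lambda>\<omega>. \<phi> (grad_f (x k \<omega>))) borel (\<lambda>\<omega>. \<psi> (P k \<omega>))"
      if "\<phi> \<in> borel_measurable borel" "\<psi> \<in> borel_measurable borel" for \<phi> \<psi> :: "_ \<Rightarrow> real"
      unfolding x using measurable_compose[OF g_meas that(1)] that(2)
      by (rule indep_var_subspace_descent[OF P_indep g_meas])
    obtain G where G: "AE \<omega> in M. norm (grad_f (x k \<omega>)) \<le> G"
      using x_bdd[of k] AE_bounded_continuous_image[OF _ f_C1] by blast
    note quad = expectation_gram_matrix_quadratic_form
        [OF ind measurable_compose[OF x_meas g_meas] G P_mean, folded q_def E_def]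
    have "AE \<omega> in M. f (x (Suc k) \<omega>) \<le> f (x k \<omega>) - \<alpha> / 2 * q \<omega>"
      using orth[of k]
    proof eventually_elim
      case (elim \<omega>)
      let ?w = "(P k \<omega> ** transpose (P k \<omega>)) *v grad_f (x k \<omega>)"
      have "f (x (Suc k) \<omega>) \<le> f (x k \<omega>) - \<alpha> * q \<omega> + lam / 2 * (\<alpha>\<^sup>2 * (norm ?w)\<^sup>2)"
        using lipschitz_gradient_quadratic_upper_bound[OF f_grad f_Lip, of "x k \<omega>" "- \<alpha> *\<^sub>R ?w"]
        by (simp add: x_Suc q_def power_mult_distrib)
      also have "lam / 2 * (\<alpha>\<^sup>2 * (norm ?w)\<^sup>2) = lam / 2 * (\<alpha>\<^sup>2 * (c * q \<omega>))"
        by (simp add: norm_gram_matrix_vector_sq[OF elim] q_def)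
      \<comment> \<open>Since \<open>\<alpha> * c * lam = 1\<close>, the second-order loss is
        exactly half of the first-order gain.\<close>
      also have "\<dots> = \<alpha> / 2 * q \<omega>"
        using \<open>c > 0\<close> \<open>lam > 0\<close> by (simp add: \<alpha>_c power2_eq_square)
      finally show ?case by simp
    qed
    then have "expectation (\<lambda>\<omega>. f (x (Suc k) \<omega>)) \<le> expectation (\<lambda>\<omega>. f (x k \<omega>) - \<alpha> / 2 * q \<omega>)"
      by (intro integral_mono_AE Bochner_Integration.integrable_diff
          Bochner_Integration.integrable_mult_right f_int quad(1))
    also have "\<dots> = expectation (\<lambda>\<omega>. f (x k \<omega>)) - \<alpha> / 2 * E k"
      by (simp add: Bochner_Integration.integral_diff f_int quad)
    finally show ?thesis .
  qed
  have telescope: "expectation (\<lambda>\<omega>. f (x k \<omega>)) + \<alpha> / 2 * (\<Sum>i<k. E i) \<le> f x0" for k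
  proof (induction k)
    case 0
    show ?case by (simp add: x prob_space)
  next
    case (Suc k)
    then show ?case using decrease[of k] by (simp add: algebra_simps)
  qed
  have min_bound: "(MIN i\<in>{0..k}. E i) \<le> C / (real k + 1)" for k
  proof -
    \<comment> \<open>Bounding the iterate after step \<open>k\<close> leaves all
      \<open>k + 1\<close> gradient terms in the telescoped sum.\<close>
    have "fstar \<le> expectation (\<lambda>\<omega>. f (x (Suc k) \<omega>))"
      using f_int f_min(2) by (intro integral_ge_const) auto
    then have "\<alpha> / 2 * (\<Sum>i<Suc k. E i) \<le> f x0 - fstar"
      using telescope[of "Suc k"] by linarith
    then have sum_le: "(\<Sum>i<Suc k. E i) \<le> C"
      using \<open>lam > 0\<close> by (simp add: \<alpha> C_def field_simps)
    \<comment> \<open>The minimum is at most the average; the left side is \<open>k + 1\<close>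
      copies of it.\<close>
    have "(\<Sum>i<Suc k. (MIN i\<in>{0..k}. E i)) \<le> (\<Sum>i<Suc k. E i)"
      by (intro sum_mono Min_le) auto
    then have "(real k + 1) * (MIN i\<in>{0..k}. E i) \<le> C"
      using sum_le by (simp add: algebra_simps)
    then show ?thesis by (simp add: field_simps)
  qed
  have complexity: "\<exists>k. real k \<le> C / \<epsilon> \<and> E k < \<epsilon>" if "\<epsilon> > 0" for \<epsilon>
  proof -
    \<comment> \<open>The least \<open>n\<close> with \<open>C / (real n + 1) < \<epsilon>\<close>;
      rounding down also keeps it within the claimed budget.\<close>
    define n where "n = nat \<lfloor>C / \<epsilon>\<rfloor>"
    have "C / \<epsilon> \<ge> 0" using \<open>f x0 \<ge> fstar\<close> \<open>lam > 0\<close> that by (simp add: C_def)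
    then have n: "real n \<le> C / \<epsilon>" "C / \<epsilon> < real n + 1"
      unfolding n_def by linarith+
    \<comment> \<open>The witness is an index attaining the minimum, which need not be
      \<open>n\<close> itself because \<open>E\<close> is not known to decrease.\<close>
    have "(MIN i\<in>{0..n}. E i) \<in> E ` {0..n}"
      by (intro Min_in) auto
    then obtain i where "i \<le> n" "E i = (MIN i\<in>{0..n}. E i)"
      by (metis atLeastAtMost_iff imageE)
    moreover have "C / (real n + 1) < \<epsilon>"
      using n(2) that by (simp add: field_simps)
    ultimately have "real i \<le> C / \<epsilon>" "E i < \<epsilon>"
      using n(1) min_bound[of n] by auto
    then show ?thesis by blast
  qed
  have "C / \<epsilon> = 2 * lam * (f x0 - fstar) * (real CARD('d) / (real CARD('l) * \<epsilon>))" for \<epsilon>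
    by (simp add: C_def)
  moreover have "C / (real k + 1) = 2 * real CARD('d) * lam * (f x0 - fstar) / ((real k + 1) * real CARD('l))" for k
    by (simp add: C_def)
  ultimately show ?thesis
    using g_int min_bound complexity unfolding E_def by simp
qed

end
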